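(* Let $n\ge 1$, $V\in C^\infty(\mathbb T^n;\mathbb R^n)$ be divergence free with mean zero, $f$ a KPP nonlinearity, and $p\in\mathbb R^n$. Denote $$c_p=\inf_{\phi\in C^1(\mathbb T^n)}\max_{\mathbb T^n}\{V(x)\cdot(p+D\phi)\}.$$ Then $$\lim_{A\to+\infty}\frac{\alpha_A(p)}{A}=\lim_{A\to+\infty}\frac{\beta_A(p)}{A}=\lim_{A\to+\infty}\frac{\gamma_A(p)}{A}=c_p.$$ In particular, the G-equation and F-equation models predict the bending effect simultaneously, i.e. $\lim_{A\to+\infty}\alpha_A(p)/A=0$ if and only if $\lim_{A\to+\infty}\gamma_A(p)/A=0$.
   Context: $\mathbb T^n=\mathbb R^n/\mathbb Z^n$ is the flat torus; functions on it are $\mathbb Z^n$-periodic functions on $\mathbb R^n$. KPP nonlinearity: $f\in C^{1,\epsilon}([0,1])$ for some $\epsilon>0$, $f(0)=f(1)=0$, $f$ is non-increasing on $(1-\epsilon,1)$, and $0<f(s)\le s f'(0)$ for $s\in(0,1)$. For $A>0$: $\alpha_A(p)$ (G-equation flame speed) is the unique number such that $|p+DG|+AV(x)\cdot(p+DG)=\alpha_A(p)$ admits approximate periodic viscosity solutions, i.e. for every $\epsilon>0$ there is a continuous periodic $G_\epsilon$ that is a viscosity subsolution with right side $\alpha_A(p)+\epsilon$ and a viscosity supersolution with right side $\alpha_A(p)-\epsilon$. It is given by $\alpha_A(p)=\inf_{\phi\in C^1(\mathbb T^n)}\max_{\mathbb T^n}\{|p+D\phi|+AV\cdot(p+D\phi)\}$.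 $\beta_A(p)$ is the unique number such that $|p+DF|^2+AV(x)\cdot(p+DF)=\beta_A(p)$ admits a periodic viscosity solution. It is given by $\beta_A(p)=\inf_{\phi\in C^1(\mathbb T^n)}\max_{\mathbb T^n}\{|p+D\phi|^2+AV\cdot(p+D\phi)\}$. $\gamma_A(p)=\inf_{\lambda>0}\frac{f'(0)+\beta_A(\lambda p)}{\lambda}$ (F-equation flame speed). The bending effect means sublinear growth of the flame speed in $A$. *)

theory Defs
  imports "HOL-Analysis.Analysis"
begin

text \<open>Functions on the flat torus are represented by their \<open>\<int>\<^sup>n\<close>-periodic lifts to \<open>\<real>\<^sup>n\<close>.\<close>

definition periodic :: "(real^'n \<Rightarrow> 'b) \<Rightarrow> bool" where
  "periodic u \<longleftrightarrow> (\<forall>x k. (\<forall>i. k $ i \<in> \<int>) \<longrightarrow> u (x + k) = u x)"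

text \<open>\<open>Ck k u\<close>: \<open>u\<close> is of class \<open>C\<^sup>k\<close> on the whole space, i.e. it is differentiable
  and all its directional derivatives are of class \<open>C\<close> to the power \<open>k - 1\<close>.\<close>

primrec Ck :: "nat \<Rightarrow> ('a::real_normed_vector \<Rightarrow> 'b::real_normed_vector) \<Rightarrow> bool" where
  "Ck 0 u \<longleftrightarrow> continuous_on UNIV u"
| "Ck (Suc k) u \<longleftrightarrow>
     (\<forall>x. u differentiable (at x)) \<and> (\<forall>v. Ck k (\<lambda>x. frechet_derivative u (at x) v))"

definition smooth :: "('a::real_normed_vector \<Rightarrow> 'b::real_normed_vector) \<Rightarrow> bool" where
  "smooth u \<longleftrightarrow> (\<forall>k. Ck k u)"

definition grad :: "('a::real_inner \<Rightarrow> real) \<Rightarrow> 'a \<Rightarrow> 'a" where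
  "grad u x = (THE D. GDERIV u x :> D)"

definition divergence :: "(real^'n \<Rightarrow> real^'n) \<Rightarrow> real^'n \<Rightarrow> real" where
  "divergence V x = trace (jacobian V (at x))"

definition divergence_free :: "(real^'n \<Rightarrow> real^'n) \<Rightarrow> bool" where
  "divergence_free V \<longleftrightarrow> (\<forall>x. divergence V x = 0)"

text \<open>\<open>cbox 0 1\<close> is the unit cube, a fundamental domain of the torus.\<close>

definition mean_zero :: "(real^'n \<Rightarrow> real^'n) \<Rightarrow> bool" where
  "mean_zero V \<longleftrightarrow> integral (cbox 0 1) V = 0"

text \<open>A nonlinearity is a function on \<open>[0,1]\<close>: derivatives are taken within that interval
  (one-sided at the end points), and the values of \<open>f\<close> elsewhere are irrelevant. The exponent
  \<open>\<epsilon>\<close> of Hoelder continuity is also the width of the interval of monotonicity.\<close>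

abbreviation deriv01 :: "(real \<Rightarrow> real) \<Rightarrow> real \<Rightarrow> real" where
  "deriv01 f s \<equiv> vector_derivative f (at s within {0..1})"

definition KPP :: "(real \<Rightarrow> real) \<Rightarrow> bool" where
  "KPP f \<longleftrightarrow>
     (\<exists>\<epsilon>>0. f differentiable_on {0..1} \<and>
        (\<exists>C. \<forall>s\<in>{0..1}. \<forall>t\<in>{0..1}. \<bar>deriv01 f s - deriv01 f t\<bar> \<le> C * \<bar>s - t\<bar> powr \<epsilon>) \<and>
        antimono_on ({1-\<epsilon><..<1} \<inter> {0..1}) f) \<and>
     f 0 = 0 \<and> f 1 = 0 \<and>
     (\<forall>s\<in>{0<..<1}. 0 < f s \<and> f s \<le> s * deriv01 f 0)"

text \<open>Viscosity sub- and supersolutions of \<open>H (x, Du) = c\<close> on the whole space,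
  with \<open>C\<^sup>1\<close> test functions touching at local extrema.\<close>

definition visc_subsolution ::
    "('a::real_inner \<Rightarrow> 'a \<Rightarrow> real) \<Rightarrow> real \<Rightarrow> ('a \<Rightarrow> real) \<Rightarrow> bool" where
  "visc_subsolution H c u \<longleftrightarrow>
     (\<forall>\<phi> x. Ck 1 \<phi> \<longrightarrow> (\<forall>\<^sub>F y in at x. u y - \<phi> y \<le> u x - \<phi> x) \<longrightarrow> H x (grad \<phi> x) \<le> c)"

definition visc_supersolution ::
    "('a::real_inner \<Rightarrow> 'a \<Rightarrow> real) \<Rightarrow> real \<Rightarrow> ('a \<Rightarrow> real) \<Rightarrow> bool" where
  "visc_supersolution H c u \<longleftrightarrow>
     (\<forall>\<phi> x. Ck 1 \<phi> \<longrightarrow> (\<forall>\<^sub>F y in at x. u y - \<phi> y \<ge> u x - \<phi> x) \<longrightarrow> H x (grad \<phi> x) \<ge> c)"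

definition G_hamiltonian :: "(real^'n \<Rightarrow> real^'n) \<Rightarrow> real \<Rightarrow> real^'n \<Rightarrow> real^'n \<Rightarrow> real^'n \<Rightarrow> real" where
  "G_hamiltonian V A p x q = norm (p + q) + A * (V x \<bullet> (p + q))"

definition F_hamiltonian :: "(real^'n \<Rightarrow> real^'n) \<Rightarrow> real \<Rightarrow> real^'n \<Rightarrow> real^'n \<Rightarrow> real^'n \<Rightarrow> real" where
  "F_hamiltonian V A p x q = (norm (p + q))\<^sup>2 + A * (V x \<bullet> (p + q))"

text \<open>The defining properties of the numbers \<open>\<alpha>\<^sub>A(p)\<close> and \<open>\<beta>\<^sub>A(p)\<close>. For \<open>A > 0\<close> and a smooth
  divergence-free field with mean zero, each of them holds for exactly one number \<open>a\<close> resp. \<open>b\<close>.\<close>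

definition is_alpha :: "(real^'n \<Rightarrow> real^'n) \<Rightarrow> real \<Rightarrow> real^'n \<Rightarrow> real \<Rightarrow> bool" where
  "is_alpha V A p a \<longleftrightarrow>
     (\<forall>\<epsilon>>0. \<exists>G. continuous_on UNIV G \<and> periodic G \<and>
        visc_subsolution (G_hamiltonian V A p) (a + \<epsilon>) G \<and>
        visc_supersolution (G_hamiltonian V A p) (a - \<epsilon>) G)"

definition is_beta :: "(real^'n \<Rightarrow> real^'n) \<Rightarrow> real \<Rightarrow> real^'n \<Rightarrow> real \<Rightarrow> bool" where
  "is_beta V A p b \<longleftrightarrow>
     (\<exists>F. continuous_on UNIV F \<and> periodic F \<and>
        visc_subsolution (F_hamiltonian V A p) b F \<and>
        visc_supersolution (F_hamiltonian V A p) b F)"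

text \<open>The flame speed \<open>\<gamma>\<^sub>A(p)\<close>, for \<open>b = \<beta>\<^sub>A\<close>.\<close>

definition gamma_speed :: "(real \<Rightarrow> real) \<Rightarrow> (real^'n \<Rightarrow> real) \<Rightarrow> real^'n \<Rightarrow> real" where
  "gamma_speed f b p = (INF l\<in>{0<..}. (deriv01 f 0 + b (l *\<^sub>R p)) / l)"

text \<open>The supremum is a maximum, since the function is continuous and periodic.\<close>

definition c_inf_max :: "(real^'n \<Rightarrow> real^'n) \<Rightarrow> real^'n \<Rightarrow> real" where
  "c_inf_max V p = (INF \<phi>\<in>{\<phi>. periodic \<phi> \<and> Ck 1 \<phi>}. SUP x. V x \<bullet> (p + grad \<phi> x))"

end

theory Submission
  imports Defs
begin

text \<open>Testing the supersolution property at a minimum of \<open>G - \<phi>\<close>, for a periodic \<open>C\<^sup>1\<close> function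
  \<open>\<phi>\<close> that is almost optimal for \<open>c\<^sub>p\<close>, gives \<open>\<alpha>\<^sub>A(p) \<le> K + A (c\<^sub>p + e)\<close>, and similarly for
  \<open>\<beta>\<^sub>A(p)\<close>. Conversely \<open>A c\<^sub>p \<le> \<alpha>\<^sub>A(p)\<close> and \<open>A c\<^sub>p \<le> \<beta>\<^sub>A(p)\<close> for every \<open>A > 0\<close>: dropping the
  nonnegative term of the Hamiltonian leaves a continuous viscosity subsolution of the linear inequality
  \<open>V \<bullet> (p + DG) \<le> c\<close>. A sup-convolution makes it semiconvex at the cost of a small error (as \<open>V\<close>
  is Lipschitz), the inequality then holds for increments in the direction of \<open>V\<close>, and it survives a
  mollification at a much smaller scale, which gives a competitor for \<open>c\<^sub>p\<close>. The bounds for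
  \<open>\<gamma>\<^sub>A(p)\<close> follow from those for \<open>\<beta>\<^sub>A\<close>: the lower one because \<open>c\<close> is positively homogeneous
  in \<open>p\<close> and \<open>f'(0) > 0\<close>, the upper one with \<open>\<lambda> = 1\<close>.\<close>

subsection \<open>Gradients and functions of class \<open>C\<^sup>1\<close>\<close>

text \<open>Uniqueness of the derivative is what gives the definite description in
  \<open>grad\<close> a value that can be computed.\<close>

lemma grad_eqI:
  fixes u :: "'a::euclidean_space \<Rightarrow> real"
  assumes "GDERIV u x :> D"
  shows "grad u x = D"
  unfolding grad_def
proof (rule the_equality)
  show "GDERIV u x :> D" by (fact assms)
next
  fix D' assume "GDERIV u x :> D'"
  then have "(\<lambda>h. h \<bullet> D') = (\<lambda>h. h \<bullet> D)"
    using assms unfolding gderiv_def by (rule has_derivative_unique)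
  from fun_cong[OF this] have "\<forall>h. h \<bullet> D' = h \<bullet> D"
    by (rule allI)
  then show "D' = D"
    by (simp only: vector_eq_ldot)
qed

lemma GDERIV_grad:
  fixes u :: "'a::euclidean_space \<Rightarrow> real"
  assumes "u differentiable (at x)"
  shows "GDERIV u x :> grad u x"
proof -
  \<comment> \<open>The adjoint of a linear functional, taken at 1, is its Riesz vector.\<close>
  let ?D = "adjoint (frechet_derivative u (at x)) 1"
  have "linear (frechet_derivative u (at x))"
    by (rule linear_frechet_derivative[OF assms])
  then have "frechet_derivative u (at x) = (\<lambda>h. h \<bullet> ?D)"
    by (simp add: adjoint_works)
  then have "GDERIV u x :> ?D"
    using assms unfolding gderiv_def frechet_derivative_works by simp
  then show ?thesis
    using grad_eqI by metis
qed

lemma Ck1_GDERIV: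
  fixes u :: "'a::euclidean_space \<Rightarrow> real"
  assumes "Ck 1 u"
  shows "GDERIV u x :> grad u x"
  using assms by (intro GDERIV_grad) simp

lemma Ck1_has_derivative_grad:
  fixes u :: "'a::euclidean_space \<Rightarrow> real"
  assumes "Ck 1 u"
  shows "(u has_derivative (\<lambda>h. h \<bullet> grad u x)) (at x)"
  using Ck1_GDERIV[OF assms] unfolding gderiv_def .

lemma Ck1_continuous_on:
  assumes "Ck 1 u"
  shows "continuous_on S u"
  using assms by (auto intro: continuous_at_imp_continuous_on differentiable_imp_continuous_within)

text \<open>\<open>Ck\<close> speaks about one direction at a time; in finite dimension the gradient
  is reassembled from its directions in \<open>Basis\<close>.\<close>

lemma Ck1_continuous_on_grad:
  fixes u :: "'a::euclidean_space \<Rightarrow> real"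
  assumes "Ck 1 u"
  shows "continuous_on UNIV (grad u)"
proof -
  have "grad u x = (\<Sum>b\<in>Basis. frechet_derivative u (at x) b *\<^sub>R b)" for x
  proof -
    have "frechet_derivative u (at x) = (\<lambda>h. h \<bullet> grad u x)"
      using Ck1_has_derivative_grad[OF assms] by (rule frechet_derivative_at[symmetric])
    then show ?thesis
      by (simp add: inner_commute[of _ "grad u x"] euclidean_representation)
  qed
  then have "grad u = (\<lambda>x. \<Sum>b\<in>Basis. frechet_derivative u (at x) b *\<^sub>R b)"
    by (rule ext)
  then show ?thesis
    using assms by (auto intro!: continuous_intros)
qed

text \<open>The derivative is an operator-valued function here because differentiation under the
  integral sign produces it in that form.\<close>

lemma Ck1I:
  assumes "\<And>x. (u has_derivative blinfun_apply (D x)) (at x)" and "continuous_on UNIV D"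
  shows "Ck 1 u"
proof -
  have "frechet_derivative u (at x) = blinfun_apply (D x)" for x
    using assms(1) by (rule frechet_derivative_at[symmetric])
  then show ?thesis
    using assms by (auto simp: differentiable_def intro!: continuous_intros)
qed

lemma Ck1_GDERIV_I:
  fixes u :: "'a::real_inner \<Rightarrow> real"
  assumes "\<And>x. GDERIV u x :> g x" and "continuous_on UNIV g"
  shows "Ck 1 u"
proof (rule Ck1I)
  show "(u has_derivative blinfun_apply (blinfun_inner_left (g x))) (at x)" for x
    using assms(1)[of x] by (simp add: gderiv_def)
  show "continuous_on UNIV (\<lambda>x. blinfun_inner_left (g x))"
    by (intro bounded_linear.continuous_on[OF bounded_linear_blinfun_inner_left] assms)
qed

subsection \<open>Periodic functions\<close>

lemma periodic_representative:
  fixes x :: "real^'n"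
  obtains k where "\<And>i. k $ i \<in> \<int>" and "x + k \<in> cbox 0 1"
proof
  let ?k = "(\<chi> i. - of_int \<lfloor>x $ i\<rfloor>) :: real^'n"
  show "?k $ i \<in> \<int>" for i
    by simp
  show "x + ?k \<in> cbox 0 1"
    unfolding mem_box_cart
  proof
    fix i
    have "of_int \<lfloor>x $ i\<rfloor> \<le> x $ i" "x $ i < of_int \<lfloor>x $ i\<rfloor> + 1"
      by linarith+
    then show "0 $ i \<le> (x + ?k) $ i \<and> (x + ?k) $ i \<le> 1 $ i"
      unfolding vector_add_component vec_lambda_beta zero_index one_index by linarith
  qed
qed

lemma periodic_bounded:
  fixes u :: "real^'n \<Rightarrow> 'b::real_normed_vector"
  assumes "periodic u" and "continuous_on UNIV u"
  obtains B where "B > 0" and "\<And>x. norm (u x) \<le> B"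
proof -
  have "compact (u ` cbox 0 1)"
    by (rule compact_continuous_image[OF continuous_on_subset[OF assms(2)] compact_cbox]) simp
  then obtain B where B: "B > 0" "\<And>x. x \<in> cbox 0 1 \<Longrightarrow> norm (u x) \<le> B"
    by (auto dest!: compact_imp_bounded simp: bounded_pos)
  have "norm (u x) \<le> B" for x
  proof -
    obtain k where k: "\<And>i. k $ i \<in> \<int>" "x + k \<in> cbox 0 1"
      using periodic_representative[of x] by blast
    then have "u (x + k) = u x"
      using assms(1) by (simp add: periodic_def)
    then show ?thesis
      using B(2)[OF k(2)] by simp
  qed
  then show thesis
    using B(1) that by blast
qed

lemma periodic_attains_inf:
  fixes u :: "real^'n \<Rightarrow> real"
  assumes "periodic u" and "continuous_on UNIV u"
  obtains x where "\<And>y. u x \<le> u y"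
proof -
  have "\<exists>x\<in>cbox (0::real^'n) 1. \<forall>y\<in>cbox 0 1. u x \<le> u y"
    using assms(2) by (intro continuous_attains_inf) (auto simp: interval_ne_empty_cart intro: continuous_on_subset)
  then obtain x where x: "\<And>y. y \<in> cbox 0 1 \<Longrightarrow> u x \<le> u y"
    by blast
  have "u x \<le> u y" for y
  proof -
    obtain k where k: "\<And>i. k $ i \<in> \<int>" "y + k \<in> cbox 0 1"
      using periodic_representative[of y] by blast
    then have "u (y + k) = u y"
      using assms(1) by (simp add: periodic_def)
    then show ?thesis
      using x[OF k(2)] by simp
  qed
  then show thesis
    using that by blast
qed

lemma periodic_uniformly_continuous:
  fixes u :: "real^'n \<Rightarrow> 'b::real_normed_vector"
  assumes "periodic u" and "continuous_on UNIV u"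
  shows "uniformly_continuous_on UNIV u"
  unfolding uniformly_continuous_on_def
proof (intro allI impI)
  fix e :: real assume "e > 0"
  \<comment> \<open>Moving \<open>x\<close> into the unit cube and a point \<open>y\<close> near
    \<open>x\<close> by the same integer vector may leave \<open>y\<close> outside that cube, but
    not outside this larger one.\<close>
  have "uniformly_continuous_on (cbox (-1) 2) u"
    by (rule compact_uniformly_continuous[OF continuous_on_subset[OF assms(2)] compact_cbox]) simp
  then obtain d where d: "d > 0"
    "\<And>x y. x \<in> cbox (-1) 2 \<Longrightarrow> y \<in> cbox (-1) 2 \<Longrightarrow> dist y x < d \<Longrightarrow> dist (u y) (u x) < e"
    using \<open>e > 0\<close> unfolding uniformly_continuous_on_def by metis
  have "dist (u y) (u x) < e" if "dist y x < min d 1" for x y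
  proof -
    obtain k where k: "\<And>i. k $ i \<in> \<int>" "x + k \<in> cbox 0 1"
      using periodic_representative[of x] by blast
    have xk: "0 \<le> x $ i + k $ i" "x $ i + k $ i \<le> 1" for i
      using k(2) by (simp_all add: mem_box_cart)
    have xy: "\<bar>y $ i - x $ i\<bar> \<le> 1" for i
      using component_le_norm_cart[of "y - x" i] that by (simp add: dist_norm)
    have "-1 \<le> y $ i + k $ i \<and> y $ i + k $ i \<le> 2" for i
      using xk[of i] xy[of i] by linarith
    then have "y + k \<in> cbox (-1) 2"
      by (simp add: mem_box_cart)
    moreover have "-1 \<le> x $ i + k $ i \<and> x $ i + k $ i \<le> 2" for i
      using xk[of i] by linarith
    then have "x + k \<in> cbox (-1) 2"
      by (simp add: mem_box_cart)
    moreover have "dist (y + k) (x + k) < d"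
      using that by simp
    ultimately have "dist (u (y + k)) (u (x + k)) < e"
      using d(2) by blast
    then show ?thesis
      using assms(1) k(1) by (simp add: periodic_def)
  qed
  then show "\<exists>d>0. \<forall>x\<in>UNIV. \<forall>x'\<in>UNIV. dist x' x < d \<longrightarrow> dist (u x') (u x) < e"
    using d(1) by (intro exI[of _ "min d 1"]) auto
qed

lemma has_derivative_periodic:
  assumes "periodic u" and "\<And>i. k $ i \<in> \<int>" and "(u has_derivative D) (at (x + k))"
  shows "(u has_derivative D) (at x)"
proof -
  have "((\<lambda>y. u (y + k)) has_derivative D) (at x)"
    by (rule has_derivative_compose[where f = "\<lambda>y. y + k" and g = u and f' = "\<lambda>h. h" and g' = D])
      (auto intro!: derivative_eq_intros simp: assms(3))
  then show ?thesis
    using assms(1,2) by (simp add: periodic_def)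
qed

lemma periodic_frechet_derivative:
  fixes u :: "real^'n \<Rightarrow> 'b::real_normed_vector"
  assumes "periodic u" and "\<And>x. u differentiable (at x)"
  shows "periodic (\<lambda>x. frechet_derivative u (at x) v)"
  unfolding periodic_def
proof (intro allI impI)
  fix x k :: "real^'n" assume "\<forall>i. k $ i \<in> \<int>"
  then have "(u has_derivative frechet_derivative u (at (x + k))) (at x)"
    using has_derivative_periodic[OF assms(1), of k] assms(2) by (metis frechet_derivative_works)
  then show "frechet_derivative u (at (x + k)) v = frechet_derivative u (at x) v"
    by (metis frechet_derivative_at)
qed

lemma periodic_grad:
  fixes u :: "real^'n \<Rightarrow> real"
  assumes "periodic u" and "Ck 1 u"
  shows "periodic (grad u)"
  unfolding periodic_def
proof (intro allI impI)
  fix x k :: "real^'n" assume "\<forall>i. k $ i \<in> \<int>"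
  then have "GDERIV u x :> grad u (x + k)"
    using has_derivative_periodic[OF assms(1), of k] Ck1_has_derivative_grad[OF assms(2), of "x + k"]
    unfolding gderiv_def by blast
  then show "grad u (x + k) = grad u x"
    using grad_eqI by metis
qed

text \<open>The partial derivatives are continuous and periodic, hence bounded. The sum of their
  bounds controls the operator norm, and the mean value inequality applies on the convex whole
  space.\<close>

lemma periodic_Ck1_lipschitz:
  fixes u :: "real^'n \<Rightarrow> 'b::real_normed_vector"
  assumes "periodic u" and "Ck 1 u"
  obtains L where "L > 0" and "\<And>x y. norm (u x - u y) \<le> L * norm (x - y)"
proof -
  have diff: "u differentiable (at x)" for x
    using assms(2) by simp
  have "\<exists>B>0. \<forall>x. norm (frechet_derivative u (at x) b) \<le> B" for b
    using periodic_bounded[OF periodic_frechet_derivative[OF assms(1) diff, of b]] assms(2)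
    by (metis One_nat_def Ck.simps)
  then obtain B where B: "\<And>b. B b > 0" "\<And>b x. norm (frechet_derivative u (at x) b) \<le> B b"
    by metis
  let ?L = "\<Sum>b\<in>Basis. B b"
  have "onorm (frechet_derivative u (at x)) \<le> ?L" for x
  proof (rule onorm_componentwise_le)
    show "bounded_linear (frechet_derivative u (at x))"
      using diff frechet_derivative_works has_derivative_bounded_linear by blast
    show "(\<Sum>b\<in>Basis. norm (frechet_derivative u (at x) b)) \<le> ?L"
      by (intro sum_mono B)
  qed
  then have "norm (u x - u y) \<le> ?L * norm (x - y)" for x y
    using diff by (intro differentiable_bound[of UNIV u "\<lambda>x. frechet_derivative u (at x)"])
      (auto simp: frechet_derivative_works)
  moreover have "?L > 0"
    using B(1) by (intro sum_pos) auto
  ultimately show thesis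
    using that by blast
qed

subsection \<open>Mollification\<close>

text \<open>The mollifier only needs to be of class \<open>C\<^sup>1\<close>, so a truncated polynomial will do.\<close>

definition bump :: "real \<Rightarrow> 'a::euclidean_space \<Rightarrow> real" where
  "bump r z = (max 0 (r\<^sup>2 - z \<bullet> z))\<^sup>2"

lemma bump_nonneg: "bump r z \<ge> 0"
  by (simp add: bump_def)

lemma continuous_on_bump: "continuous_on S (bump r)"
  unfolding bump_def by (intro continuous_intros)

lemma bump_eq_0:
  assumes "r > 0" and "norm z \<ge> r"
  shows "bump r z = 0"
  using power_mono[OF assms(2), of 2] assms(1) by (simp add: bump_def power2_norm_eq_inner)

lemma not_in_cbox_One:
  assumes "z \<notin> cbox (- (r *\<^sub>R One)) (r *\<^sub>R One)"
  shows "norm (z::'a::euclidean_space) \<ge> r"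
proof -
  obtain b where "b \<in> Basis" "\<bar>z \<bullet> b\<bar> > r"
    using assms by (auto simp: mem_box abs_le_iff not_le)
  then show ?thesis
    using Basis_le_norm[of b z] by linarith
qed

text \<open>Squaring removes the kink of the positive part: at 0 the difference quotient is at most
  \<open>\<bar>h\<bar>\<close>. This makes \<open>bump\<close> continuously differentiable.\<close>

lemma DERIV_max_0_square: "((\<lambda>s::real. (max 0 s)\<^sup>2) has_real_derivative 2 * max 0 s) (at s)"
proof (cases "s = 0")
  case True
  have "((\<lambda>h. (max 0 h)\<^sup>2 / h) \<longlongrightarrow> 0) (at (0::real))"
  proof (rule Lim_null_comparison)
    show "\<forall>\<^sub>F h in at 0. norm ((max 0 h)\<^sup>2 / h) \<le> \<bar>h\<bar>"
      by (auto simp: eventually_at_filter max_def power2_eq_square)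
    show "((\<lambda>h. \<bar>h\<bar>) \<longlongrightarrow> 0) (at (0::real))"
      using tendsto_rabs_zero[OF tendsto_ident_at] .
  qed
  then show ?thesis
    using True by (simp add: DERIV_def)
next
  case False
  then consider "s < 0" | "s > 0" by linarith
  then show ?thesis
  proof cases
    case 1
    have "((\<lambda>s::real. 0) has_real_derivative 2 * max 0 s) (at s)"
      using 1 by simp
    then show ?thesis
      by (rule has_field_derivative_transform_within_open[where S = "{..<0}"])
        (use 1 in auto)
  next
    case 2
    have "((\<lambda>s::real. s\<^sup>2) has_real_derivative 2 * max 0 s) (at s)"
      using 2 by (auto intro!: derivative_eq_intros)
    then show ?thesis
      by (rule has_field_derivative_transform_within_open[where S = "{0<..}"])
        (use 2 in auto)
  qed
qed

definition bump_grad :: "real \<Rightarrow> 'a::euclidean_space \<Rightarrow> 'a" where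
  "bump_grad r z = - (4 * max 0 (r\<^sup>2 - z \<bullet> z)) *\<^sub>R z"

lemma GDERIV_bump: "GDERIV (bump r) z :> bump_grad r z"
proof -
  have "GDERIV (\<lambda>z. r\<^sup>2 - z \<bullet> z) z :> - 2 *\<^sub>R z"
    unfolding gderiv_def by (auto intro!: derivative_eq_intros simp: inner_commute)
  from GDERIV_DERIV_compose[OF this DERIV_max_0_square] show ?thesis
    by (simp add: bump_def[abs_def] bump_grad_def)
qed

lemma continuous_on_bump_grad: "continuous_on S (bump_grad r)"
  unfolding bump_grad_def by (intro continuous_intros)

lemma bump_grad_eq_0:
  assumes "r > 0" and "norm z \<ge> r"
  shows "bump_grad r z = 0"
  using power_mono[OF assms(2), of 2] assms(1) by (simp add: bump_grad_def power2_norm_eq_inner)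

lemma integral_bump_pos:
  assumes "r > 0"
  shows "integral (cbox (- (r *\<^sub>R One)) (r *\<^sub>R One)) (bump r :: 'a::euclidean_space \<Rightarrow> real) > 0"
proof -
  let ?B = "cbox (- (r *\<^sub>R One)) (r *\<^sub>R One) :: 'a set"
  have int: "bump r integrable_on ?B"
    by (intro integrable_continuous continuous_on_bump)
  have "integral ?B (bump r) \<noteq> 0"
  proof
    assume "integral ?B (bump r) = 0"
    then have "(bump r has_integral 0) ?B"
      using int by (metis integrable_integral)
    moreover have "0 \<in> box (- (r *\<^sub>R One)) (r *\<^sub>R One :: 'a)"
      using assms by (simp add: mem_box)
    ultimately have "bump r (0::'a) = 0"
      using box_subset_cbox
      by (intro has_integral_0_cbox_imp_0[OF continuous_on_bump bump_nonneg]) auto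
    then show False
      using assms by (simp add: bump_def)
  qed
  moreover have "integral ?B (bump r) \<ge> 0"
    by (intro integral_nonneg int bump_nonneg)
  ultimately show ?thesis
    by linarith
qed

text \<open>The substitution \<open>y = x - z\<close> moves the dependence on \<open>x\<close> from
  the merely continuous \<open>u\<close> to the kernel, and the support condition allows a domain
  that does not move with \<open>x\<close>. The kernel is vector-valued so that the lemma covers
  both the bump and its operator-valued derivative.\<close>

lemma integral_convolution:
  fixes k :: "'a::euclidean_space \<Rightarrow> 'b::banach" and u :: "'a \<Rightarrow> real"
  assumes k: "continuous_on UNIV k" and u: "continuous_on UNIV u"
    and supp: "\<And>z. z \<notin> cbox (- a) a \<Longrightarrow> k z = 0"
    and sub: "cbox (x - a) (x + a) \<subseteq> cbox c d"
  shows "integral (cbox (- a) a) (\<lambda>z. u (x - z) *\<^sub>R k z) = integral (cbox c d) (\<lambda>y. u y *\<^sub>R k (x - y))"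
proof -
  let ?g = "\<lambda>y. u y *\<^sub>R k (x - y)"
  have "continuous_on S ?g" for S
    by (intro continuous_intros continuous_on_subset[OF u] continuous_on_compose2[OF k]) auto
  then have int: "?g integrable_on cbox (x - a) (x + a)"
    by (intro integrable_continuous)
  have "integral (cbox (- a) a) (\<lambda>z. u (x - z) *\<^sub>R k z)
      = integral (cbox (- a) a) (\<lambda>z. u (x + z) *\<^sub>R k (- z))"
    using integral_reflect[of a "- a" "\<lambda>z. u (x - z) *\<^sub>R k z"] by simp
  also have "\<dots> = integral (cbox (x - a) (x + a)) ?g"
    using integral_shift_cbox[of "x - a" x "x + a" ?g] by (simp add: add.commute)
  also have "\<dots> = integral (cbox c d) ?g"
  proof (rule integral_unique[symmetric], rule has_integral_on_superset[OF integrable_integral[OF int] _ sub])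
    fix y assume "y \<notin> cbox (x - a) (x + a)"
    then have "x - y \<notin> cbox (- a) a"
      by (force simp: mem_box inner_diff_left inner_add_left)
    then show "?g y = 0"
      using supp by simp
  qed
  finally show ?thesis .
qed

lemma Ck1_convolution_bump:
  fixes u :: "'a::euclidean_space \<Rightarrow> real"
  assumes u: "continuous_on UNIV u" and r: "r > 0"
  shows "Ck 1 (\<lambda>x. integral (cbox (- (r *\<^sub>R One)) (r *\<^sub>R One)) (\<lambda>z. u (x - z) * bump r z))"
proof -
  let ?a = "r *\<^sub>R One :: 'a"
  let ?k' = "\<lambda>z::'a. blinfun_inner_left (bump_grad r z)"
  let ?w = "\<lambda>x. integral (cbox (- ?a) ?a) (\<lambda>z. u (x - z) * bump r z)"
  let ?D = "\<lambda>x. integral (cbox (- ?a) ?a) (\<lambda>z. u (x - z) *\<^sub>R ?k' z)"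
  have k': "continuous_on S (\<lambda>x. ?k' (g x))" if "continuous_on S g" for S and g :: "'c::topological_space \<Rightarrow> 'a"
    by (intro bounded_linear.continuous_on[OF bounded_linear_blinfun_inner_left]
        continuous_on_compose2[OF continuous_on_bump_grad[of UNIV] that]) auto
  have u': "continuous_on S (\<lambda>x. u (g x))" if "continuous_on S g" for S and g :: "'c::topological_space \<Rightarrow> 'a"
    by (intro continuous_on_compose2[OF u that]) auto
  have b': "continuous_on S (\<lambda>x. bump r (g x))" if "continuous_on S g" for S and g :: "'c::topological_space \<Rightarrow> 'a"
    by (intro continuous_on_compose2[OF continuous_on_bump[of UNIV] that]) auto
  have supp: "bump r z = 0" "?k' z = 0" if "z \<notin> cbox (- ?a) ?a" for z
  proof -
    have "norm z \<ge> r" using not_in_cbox_One[OF that] .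
    then show "bump r z = 0" "?k' z = 0"
      using r by (auto simp: bump_eq_0 bump_grad_eq_0 blinfun_eqI)
  qed
  show ?thesis
  proof (rule Ck1I)
    fix x0 :: 'a
    \<comment> \<open>One domain of integration for all \<open>x\<close> in the unit ball around
      \<open>x0\<close>, as differentiation under the integral sign requires.\<close>
    let ?B = "cbox (x0 - (?a + One)) (x0 + (?a + One))"
    have sub: "cbox (x - ?a) (x + ?a) \<subseteq> ?B" if "x \<in> ball x0 1" for x
    proof -
      have "\<bar>x0 \<bullet> b - x \<bullet> b\<bar> \<le> 1" if "b \<in> Basis" for b
        using Basis_le_norm[OF that, of "x0 - x"] \<open>x \<in> ball x0 1\<close>
        by (simp add: dist_norm inner_diff_left)
      then show ?thesis
        by (intro subset_box_imp) (force simp: inner_diff_left inner_add_left abs_le_iff)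
    qed
    have "((\<lambda>x. integral ?B (\<lambda>y. u y * bump r (x - y))) has_derivative
        blinfun_apply (integral ?B (\<lambda>y. u y *\<^sub>R ?k' (x0 - y)))) (at x0 within ball x0 1)"
    proof (rule leibniz_rule)
      fix x t :: 'a
      have "((\<lambda>x. x - t) has_derivative (\<lambda>h. h)) (at x)"
        by (auto intro!: derivative_eq_intros)
      from has_derivative_compose[OF this GDERIV_bump[of r "x - t", unfolded gderiv_def]]
      have "((\<lambda>x. u t * bump r (x - t)) has_derivative (\<lambda>h. u t * (h \<bullet> bump_grad r (x - t))))
          (at x within ball x0 1)"
        by (rule has_derivative_mult_right[OF has_derivative_at_withinI])
      moreover have "blinfun_apply (u t *\<^sub>R ?k' (x - t)) = (\<lambda>h. u t * (h \<bullet> bump_grad r (x - t)))"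
        by (rule ext) (simp add: blinfun.scaleR_left)
      ultimately show "((\<lambda>x. u t * bump r (x - t)) has_derivative
          blinfun_apply (u t *\<^sub>R ?k' (x - t))) (at x within ball x0 1)"
        by simp
    next
      fix x :: 'a
      show "(\<lambda>y. u y * bump r (x - y)) integrable_on ?B"
        by (intro integrable_continuous continuous_intros u' b')
    next
      show "continuous_on (ball x0 1 \<times> ?B) (\<lambda>(x, t). u t *\<^sub>R ?k' (x - t))"
        unfolding split_beta by (intro continuous_intros u' k')
    qed auto
    \<comment> \<open>Substituting back gives the derivative as an integral over a box independent
      of \<open>x0\<close>, so that its continuity is that of a parameter integral.\<close>
    then have "((\<lambda>x. integral ?B (\<lambda>y. u y * bump r (x - y))) has_derivative blinfun_apply (?D x0)) (at x0)"
      using integral_convolution[OF k' u supp(2) sub[of x0]]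
      by (simp add: at_within_open[OF _ open_ball])
    then show "(?w has_derivative blinfun_apply (?D x0)) (at x0)"
    proof (rule has_derivative_transform_within_open)
      fix x assume "x \<in> ball x0 1"
      then show "integral ?B (\<lambda>y. u y * bump r (x - y)) = ?w x"
        using integral_convolution[OF continuous_on_bump u supp(1) sub[of x]] by simp
    qed auto
  next
    show "continuous_on UNIV ?D"
      by (rule integral_continuous_on_param) (unfold split_beta, intro continuous_intros u' k')
  qed
qed

text \<open>The mollification is a weighted average of translates of \<open>u\<close> by vectors
  shorter than \<open>r\<close>, so it inherits periods and one-sided bounds on increments.
  Increments replace gradients because \<open>u\<close> is only continuous.\<close>

lemma mollification:
  fixes u :: "'a::euclidean_space \<Rightarrow> real"
  assumes u: "continuous_on UNIV u" and r: "r > 0"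
  obtains w where "Ck 1 w"
    and "\<And>k x. (\<And>y. u (y + k) = u y) \<Longrightarrow> w (x + k) = w x"
    and "\<And>x v c. (\<And>y. dist x y \<le> r \<Longrightarrow> u y - u (y - v) \<le> c) \<Longrightarrow> w x - w (x - v) \<le> c"
proof -
  let ?B = "cbox (- (r *\<^sub>R One)) (r *\<^sub>R One) :: 'a set"
  define K where "K = integral ?B (bump r)"
  define W where "W = (\<lambda>x. integral ?B (\<lambda>z. u (x - z) * bump r z))"
  have K: "K > 0"
    unfolding K_def by (rule integral_bump_pos[OF r])
  show thesis
  proof
    have "Ck 1 W"
      unfolding W_def by (rule Ck1_convolution_bump[OF u r])
    have "GDERIV (\<lambda>x. W x / K) x :> (1 / K) *\<^sub>R grad W x" for x
      using Ck1_has_derivative_grad[OF \<open>Ck 1 W\<close>, of x] K unfolding gderiv_def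
      by (auto intro!: derivative_eq_intros simp: field_simps)
    then show "Ck 1 (\<lambda>x. W x / K)"
      by (rule Ck1_GDERIV_I) (intro continuous_intros Ck1_continuous_on_grad \<open>Ck 1 W\<close>)
  next
    fix k x assume "\<And>y. u (y + k) = u y"
    from this[of "x - _"] show "W (x + k) / K = W x / K"
      by (simp add: W_def algebra_simps)
  next
    fix x v c assume *: "\<And>y. dist x y \<le> r \<Longrightarrow> u y - u (y - v) \<le> c"
    have int: "(\<lambda>z. u (x - z) * bump r z) integrable_on ?B" for x
      by (intro integrable_continuous continuous_intros continuous_on_bump continuous_on_compose2[OF u]) auto
    have int': "bump r integrable_on ?B"
      by (intro integrable_continuous continuous_on_bump)
    have "W x - W (x - v) = integral ?B (\<lambda>z. u (x - z) * bump r z - u (x - v - z) * bump r z)"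
      unfolding W_def by (rule integral_diff[OF int int, symmetric])
    also have "\<dots> \<le> integral ?B (\<lambda>z. c * bump r z)"
    proof (rule integral_le)
      fix z :: 'a
      show "u (x - z) * bump r z - u (x - v - z) * bump r z \<le> c * bump r z"
      \<comment> \<open>The hypothesis on increments is available only within distance
        \<open>r\<close>; elsewhere in the cube the weight vanishes.\<close>
      proof (cases "norm z \<ge> r")
        case False
        then have "u (x - z) - u (x - z - v) \<le> c"
          by (intro *) (simp add: dist_norm)
        then have "(u (x - z) - u (x - z - v)) * bump r z \<le> c * bump r z"
          by (rule mult_right_mono[OF _ bump_nonneg])
        then show ?thesis
          by (simp add: algebra_simps)
      qed (simp add: bump_eq_0[OF r])
    qed (auto intro: integrable_diff int int' integrable_on_mult_right)
    also have "\<dots> = c * K"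
      by (simp add: K_def)
    finally show "W x / K - W (x - v) / K \<le> c"
      using K by (simp add: field_simps)
  qed
qed

subsection \<open>Regularization of viscosity subsolutions\<close>

text \<open>\<open>u y\<close> is the maximum over \<open>z\<close> of \<open>G z\<close> minus a
  quadratic penalty. Of the two bounds on the maximizer, the second says that its distance from
  \<open>y\<close> times the slope \<open>norm (y - z) / d\<close> of the penalty is at most
  \<open>t\<close>, even though the slope itself may be large.\<close>

lemma sup_convolution:
  fixes G :: "real^'n \<Rightarrow> real"
  assumes per: "periodic G" and cont: "continuous_on UNIV G" and t: "t > 0"
  obtains d u where "d > 0" and "periodic u" and "continuous_on UNIV u"
    and "\<And>y z. G z - (norm (y - z))\<^sup>2 / (2 * d) \<le> u y"
    and "\<And>y. \<exists>z. u y = G z - (norm (y - z))\<^sup>2 / (2 * d) \<and> norm (y - z) \<le> t \<and> (norm (y - z))\<^sup>2 \<le> t * d"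
proof -
  obtain M where M: "M > 0" "\<And>x. \<bar>G x\<bar> \<le> M"
    using periodic_bounded[OF per cont] by auto
  obtain s where s: "s > 0" "\<And>x y. norm (x - y) < s \<Longrightarrow> \<bar>G x - G y\<bar> < t / 2"
    using periodic_uniformly_continuous[OF per cont] t
    unfolding uniformly_continuous_on_def dist_norm real_norm_def by (meson UNIV_I half_gt_zero)
  \<comment> \<open>\<open>d\<close> is so small that at distance \<open>m\<close> the penalty
    exceeds \<open>2 * M\<close>, a bound for the oscillation of \<open>G\<close>. Maximizers over
    the ball of radius \<open>m\<close> are therefore global.\<close>
  define m where "m = min s t"
  define d where "d = m\<^sup>2 / (8 * M)"
  have m: "m > 0" "m \<le> s" "m \<le> t"
    using s(1) t by (auto simp: m_def)
  have d: "d > 0" and "4 * M * d < m\<^sup>2"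
    using m(1) M(1) by (auto simp: d_def)
  let ?q = "\<lambda>y z. G z - (norm (y - z))\<^sup>2 / (2 * d)"
  have "\<exists>z. (\<forall>z'. ?q y z' \<le> ?q y z) \<and> norm (y - z) \<le> t \<and> (norm (y - z))\<^sup>2 \<le> t * d" for y
  proof -
    have "continuous_on (cball y m) (?q y)"
      using d by (intro continuous_intros continuous_on_subset[OF cont]) auto
    then obtain z where z: "z \<in> cball y m" "\<And>z'. z' \<in> cball y m \<Longrightarrow> ?q y z' \<le> ?q y z"
      using continuous_attains_sup[of "cball y m" "?q y"] m(1) by auto
    \<comment> \<open>Comparison with \<open>y\<close> itself bounds the penalty at the maximizer by
      an increment of \<open>G\<close>: first by \<open>2 * M\<close>, which puts \<open>z\<close>
      within distance \<open>s\<close>, and then by \<open>t / 2\<close>.\<close>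
    have yz: "G y \<le> ?q y z"
      using z(2)[of y] m(1) by simp
    have max: "?q y z' \<le> ?q y z" for z'
    proof (cases "z' \<in> cball y m")
      case False
      then have "m\<^sup>2 \<le> (norm (y - z'))\<^sup>2"
        using m(1) by (intro power_mono) (auto simp: dist_norm)
      then have "2 * M \<le> (norm (y - z'))\<^sup>2 / (2 * d)"
        using d \<open>4 * M * d < m\<^sup>2\<close> by (simp add: field_simps)
      then show ?thesis
        using yz M(2)[of y] M(2)[of z'] by linarith
    qed (use z(2) in auto)
    have "(norm (y - z))\<^sup>2 / (2 * d) \<le> 2 * M"
      using yz M(2)[of y] M(2)[of z] by linarith
    then have "(norm (y - z))\<^sup>2 < m\<^sup>2"
      using d \<open>4 * M * d < m\<^sup>2\<close> by (simp add: field_simps)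
    then have ym: "norm (y - z) < m"
      using m(1) by (intro power_less_imp_less_base[of _ 2 m]) auto
    then have "\<bar>G y - G z\<bar> < t / 2"
      using m by (intro s(2)) auto
    then have "(norm (y - z))\<^sup>2 / (2 * d) \<le> t / 2"
      using yz by linarith
    then have "(norm (y - z))\<^sup>2 \<le> t * d"
      using d by (simp add: field_simps)
    then show ?thesis
      using max ym m by (intro exI[of _ z]) auto
  qed
  then obtain Z where Z: "\<And>y z. ?q y z \<le> ?q y (Z y)" "\<And>y. norm (y - Z y) \<le> t"
      "\<And>y. (norm (y - Z y))\<^sup>2 \<le> t * d"
    by metis
  show thesis
  proof
    show "d > 0" by (rule d)
    show "periodic (\<lambda>y. ?q y (Z y))"
      unfolding periodic_def
    proof (intro allI impI antisym)
      fix x k :: "real^'n" assume k: "\<forall>i. k $ i \<in> \<int>"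
      have per': "G (z + k) = G z" for z
        using per k by (simp add: periodic_def)
      show "?q (x + k) (Z (x + k)) \<le> ?q x (Z x)"
        using Z(1)[of "Z (x + k) - k" x] per'[of "Z (x + k) - k"] by (simp add: algebra_simps)
      show "?q x (Z x) \<le> ?q (x + k) (Z (x + k))"
        using Z(1)[of "Z x + k" "x + k"] per'[of "Z x"] by simp
    qed
    \<comment> \<open>The maximizer for \<open>y\<close> is used as a competitor for
      \<open>y'\<close>; with the roles exchanged this also gives continuity.\<close>
    have le: "?q y (Z y) - ?q y' (Z y') \<le> norm (y' - y) * (norm (y' - y) + 2 * t) / (2 * d)" for y y'
    proof -
      have "norm (y' - Z y) \<le> norm (y' - y) + norm (y - Z y)"
        using norm_triangle_ineq[of "y' - y" "y - Z y"] by simp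
      then have "(norm (y' - Z y))\<^sup>2 \<le> (norm (y' - y) + norm (y - Z y))\<^sup>2"
        by (intro power_mono) auto
      also have "\<dots> = (norm (y - Z y))\<^sup>2 + norm (y' - y) * (norm (y' - y) + 2 * norm (y - Z y))"
        by (simp add: power2_eq_square algebra_simps)
      also have "\<dots> \<le> (norm (y - Z y))\<^sup>2 + norm (y' - y) * (norm (y' - y) + 2 * t)"
        using Z(2)[of y] by (intro add_left_mono mult_left_mono) auto
      finally have "((norm (y' - Z y))\<^sup>2 - (norm (y - Z y))\<^sup>2) / (2 * d)
          \<le> norm (y' - y) * (norm (y' - y) + 2 * t) / (2 * d)"
        using d by (intro divide_right_mono) auto
      then show ?thesis
        using Z(1)[of "Z y" y'] by (simp add: diff_divide_distrib)
    qed
    show "continuous_on UNIV (\<lambda>y. ?q y (Z y))"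
      unfolding continuous_on_def
    proof
      fix y
      have "((\<lambda>y'. ?q y' (Z y') - ?q y (Z y)) \<longlongrightarrow> 0) (at y)"
      proof (rule Lim_null_comparison)
        have "norm (?q y' (Z y') - ?q y (Z y)) \<le> norm (y' - y) * (norm (y' - y) + 2 * t) / (2 * d)" for y'
          using le[of y y'] le[of y' y] unfolding real_norm_def abs_le_iff norm_minus_commute[of y y'] by linarith
        then show "\<forall>\<^sub>F y' in at y. norm (?q y' (Z y') - ?q y (Z y))
            \<le> norm (y' - y) * (norm (y' - y) + 2 * t) / (2 * d)"
          by simp
        have "((\<lambda>y'. norm (y' - y) * (norm (y' - y) + 2 * t) / (2 * d))
            \<longlongrightarrow> norm (y - y) * (norm (y - y) + 2 * t) / (2 * d)) (at y)"
          using d by (intro tendsto_intros) auto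
        then show "((\<lambda>y'. norm (y' - y) * (norm (y' - y) + 2 * t) / (2 * d)) \<longlongrightarrow> 0) (at y)"
          by simp
      qed
      then show "((\<lambda>y. ?q y (Z y)) \<longlongrightarrow> ?q y (Z y)) (at y within UNIV)"
        by (rule LIM_zero_cancel)
    qed
    show "?q y z \<le> ?q y (Z y)" for y z
      by (rule Z(1))
    show "\<exists>z. ?q y (Z y) = ?q y z \<and> norm (y - z) \<le> t \<and> (norm (y - z))\<^sup>2 \<le> t * d" for y
      using Z by blast
  qed
qed

lemma GDERIV_paraboloid:
  fixes y :: "'a::real_inner"
  shows "GDERIV (\<lambda>z. (norm (y - z))\<^sup>2 / (2 * d)) z :> (1 / d) *\<^sub>R (z - y)"
proof -
  have "((\<lambda>z. (norm (y - z))\<^sup>2) has_derivative (\<lambda>h. 2 * (h \<bullet> (z - y)))) (at z)"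
    unfolding power2_norm_eq_inner
    by (rule derivative_eq_intros | simp add: inner_commute algebra_simps)+
  from has_derivative_mult_left[OF this, of "1 / (2 * d)"] show ?thesis
    unfolding gderiv_def by simp
qed

text \<open>After division by \<open>h\<close> the quadratic term vanishes as \<open>h\<close> tends
  to 0, so \<open>K\<close> may be arbitrarily large; below it contains
  \<open>1 / d\<close>.\<close>

lemma grad_inner_le_of_increments:
  fixes w :: "'a::euclidean_space \<Rightarrow> real"
  assumes "Ck 1 w" and "\<And>h. h > 0 \<Longrightarrow> w x - w (x - h *\<^sub>R v) \<le> h * C + h\<^sup>2 * K"
  shows "v \<bullet> grad w x \<le> C"
proof (rule ccontr)
  assume "\<not> v \<bullet> grad w x \<le> C"
  let ?\<psi> = "\<lambda>h. w x - w (x - h *\<^sub>R v) - h * C - h\<^sup>2 * K"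
  have "((\<lambda>h. x - h *\<^sub>R v) has_derivative (\<lambda>h. - (h *\<^sub>R v))) (at 0)"
    by (auto intro!: derivative_eq_intros)
  moreover have "(w has_derivative (\<lambda>h. h \<bullet> grad w x)) (at (x - 0 *\<^sub>R v))"
    using Ck1_has_derivative_grad[OF assms(1)] by simp
  ultimately have "((\<lambda>h. w (x - h *\<^sub>R v)) has_derivative (\<lambda>h. - (h *\<^sub>R v) \<bullet> grad w x)) (at 0)"
    by (rule has_derivative_compose)
  then have "((\<lambda>h. w (x - h *\<^sub>R v)) has_real_derivative - (v \<bullet> grad w x)) (at 0)"
    unfolding has_field_derivative_def by (rule has_derivative_eq_rhs) (simp add: fun_eq_iff)
  then have "(?\<psi> has_real_derivative v \<bullet> grad w x - C) (at 0)"
    by (auto intro!: derivative_eq_intros)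
  from DERIV_pos_inc_right[OF this] \<open>\<not> v \<bullet> grad w x \<le> C\<close>
  obtain d where "d > 0" "\<And>h. h > 0 \<Longrightarrow> h < d \<Longrightarrow> ?\<psi> 0 < ?\<psi> (0 + h)"
    by auto
  from this(1) this(2)[of "d / 2"] have "?\<psi> (d / 2) > 0"
    by simp
  then show False
    using assms(2)[of "d / 2"] \<open>d > 0\<close> by simp
qed

text \<open>The paraboloid of the sup-convolution serves twice: as a test function touching
  \<open>G\<close> from above at the maximizer \<open>z\<close>, and as a lower barrier for
  \<open>u\<close>, which turns the inequality at \<open>z\<close> into a bound on increments of
  \<open>u\<close>.\<close>

lemma visc_subsolution_linear_approx:
  fixes V :: "real^'n \<Rightarrow> real^'n"
  assumes V: "periodic V" "Ck 1 V" and G: "periodic G" "continuous_on UNIV G"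
    and sub: "visc_subsolution (\<lambda>x q. V x \<bullet> (p + q)) c G" and e: "e > 0"
  obtains \<phi> where "periodic \<phi>" and "Ck 1 \<phi>" and "\<And>x. V x \<bullet> (p + grad \<phi> x) \<le> c + e"
proof -
  obtain L where L: "L > 0" "\<And>x y. norm (V x - V y) \<le> L * norm (x - y)"
    using periodic_Ck1_lipschitz[OF V] by blast
  \<comment> \<open>The error terms below add up to \<open>L * (2 * t * norm p + 2 * t)\<close>,
    which this choice makes equal to \<open>e\<close>.\<close>
  define N where "N = 2 * L * (norm p + 1)"
  define t where "t = e / N"
  have "N > 0"
    using norm_ge_zero[of p] L(1) unfolding N_def by (intro mult_pos_pos) linarith+
  then have "t > 0" "N * t = e"
    using e by (simp_all add: t_def)
  then have t: "t > 0" "2 * L * (norm p + 1) * t = e"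
    by (simp_all only: N_def)
  obtain d u where d: "d > 0" and u: "periodic u" "continuous_on UNIV u"
    and ge: "\<And>y z. G z - (norm (y - z))\<^sup>2 / (2 * d) \<le> u y"
    and ex: "\<And>y. \<exists>z. u y = G z - (norm (y - z))\<^sup>2 / (2 * d) \<and> norm (y - z) \<le> t \<and> (norm (y - z))\<^sup>2 \<le> t * d"
    using sup_convolution[OF G t(1)] by blast
  \<comment> \<open>Slopes of the paraboloid are of size \<open>norm (y - z) / d\<close>, so the
    mollification scale must not exceed \<open>d\<close> either.\<close>
  define r where "r = min t d"
  have r: "r > 0" "r \<le> t" "r \<le> d"
    using t(1) d by (auto simp: r_def)
  \<comment> \<open>The direction is frozen at \<open>x\<close> while \<open>y\<close> varies over
    the ball that is averaged; mollification preserves bounds for a fixed increment vector.\<close>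
  have incr: "u y - u (y - h *\<^sub>R V x)
      \<le> h * (c + e - V x \<bullet> p) + h\<^sup>2 * ((norm (V x))\<^sup>2 / (2 * d))"
    if "dist x y \<le> r" "h > 0" for x y h
  proof -
    obtain z where z: "u y = G z - (norm (y - z))\<^sup>2 / (2 * d)" "norm (y - z) \<le> t" "(norm (y - z))\<^sup>2 \<le> t * d"
      using ex by blast
    define q where "q = (1 / d) *\<^sub>R (z - y)"
    let ?P = "\<lambda>z. (norm (y - z))\<^sup>2 / (2 * d)"
    have "Ck 1 ?P"
      by (rule Ck1_GDERIV_I[OF GDERIV_paraboloid]) (intro continuous_intros)
    moreover have "\<forall>\<^sub>F z' in at z. G z' - ?P z' \<le> G z - ?P z"
      unfolding z(1)[symmetric] by (intro always_eventually allI ge)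
    ultimately have "V z \<bullet> (p + grad ?P z) \<le> c"
      using sub unfolding visc_subsolution_def by blast
    then have Vz: "V z \<bullet> (p + q) \<le> c"
      unfolding q_def grad_eqI[OF GDERIV_paraboloid] .
    have "norm (x - z) \<le> r + norm (y - z)"
      using that(1) norm_triangle_ineq[of "x - y" "y - z"] by (simp add: dist_norm)
    then have "norm (V x - V z) \<le> L * (r + norm (y - z))"
      using L(2)[of x z] mult_left_mono[of _ _ L] L(1) by (meson less_imp_le order_trans)
    moreover have "norm (p + q) \<le> norm p + norm (y - z) / d"
      using norm_triangle_ineq[of p q] d by (simp add: q_def norm_minus_commute)
    \<comment> \<open>The price of replacing \<open>V z\<close> by \<open>V x\<close>. The slope
      need not be small, but its products with \<open>norm (y - z)\<close> and with \<open>r\<close>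
      are at most \<open>t\<close>.\<close>
    ultimately have "(V x - V z) \<bullet> (p + q) \<le> L * (r + norm (y - z)) * (norm p + norm (y - z) / d)"
      by (meson norm_cauchy_schwarz mult_mono' norm_ge_zero order_trans)
    also have "\<dots> = L * (r * norm p + norm (y - z) * norm p + r / d * norm (y - z) + (norm (y - z))\<^sup>2 / d)"
      using d by (simp add: field_simps power2_eq_square)
    also have "\<dots> \<le> L * (t * norm p + t * norm p + 1 * t + t)"
      using r z(2,3) d L(1)
      by (intro mult_left_mono add_mono mult_right_mono mult_mono) (auto simp: field_simps)
    also have "\<dots> = e"
      using t(2) by (simp add: algebra_simps)
    finally have "V x \<bullet> q \<le> c + e - V x \<bullet> p"
      using Vz by (simp add: inner_diff_left inner_add_right)
    then have "h * (V x \<bullet> q) \<le> h * (c + e - V x \<bullet> p)"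
      using that(2) by simp
    \<comment> \<open>\<open>z\<close> is still a competitor at the shifted point, so the increment
      is at most that of a paraboloid, whose first-order part is
      \<open>h * (V x \<bullet> q)\<close>.\<close>
    moreover have "u y - u (y - h *\<^sub>R V x) \<le> ((norm (y - h *\<^sub>R V x - z))\<^sup>2 - (norm (y - z))\<^sup>2) / (2 * d)"
      using ge[of z "y - h *\<^sub>R V x"] z(1) by (simp add: diff_divide_distrib)
    moreover have "(norm (y - h *\<^sub>R V x - z))\<^sup>2 - (norm (y - z))\<^sup>2
        = 2 * h * (V x \<bullet> (z - y)) + h\<^sup>2 * (norm (V x))\<^sup>2"
      unfolding power2_norm_eq_inner
      by (simp add: inner_diff_left inner_diff_right inner_commute power2_eq_square algebra_simps)
    ultimately show ?thesis
      using d by (simp add: q_def add_divide_distrib)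
  qed
  obtain w where w: "Ck 1 w" "\<And>k x. (\<And>y. u (y + k) = u y) \<Longrightarrow> w (x + k) = w x"
    "\<And>x v C. (\<And>y. dist x y \<le> r \<Longrightarrow> u y - u (y - v) \<le> C) \<Longrightarrow> w x - w (x - v) \<le> C"
    using mollification[OF u(2) r(1)] by blast
  show thesis
  proof
    show "periodic w"
      using u(1) w(2) by (simp add: periodic_def)
    show "Ck 1 w" by (rule w(1))
    show "V x \<bullet> (p + grad w x) \<le> c + e" for x
    proof -
      have "V x \<bullet> grad w x \<le> c + e - V x \<bullet> p"
        by (rule grad_inner_le_of_increments[OF w(1)], rule w(3), rule incr)
      then show ?thesis
        by (simp add: inner_add_right)
    qed
  qed
qed

subsection \<open>The limiting constant\<close>

lemma bdd_above_inner_grad: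
  fixes V :: "real^'n \<Rightarrow> real^'n"
  assumes "periodic V" "continuous_on UNIV V" "periodic \<phi>" "Ck 1 \<phi>"
  shows "bdd_above (range (\<lambda>x. V x \<bullet> (p + grad \<phi> x)))"
proof -
  have "periodic (\<lambda>x. V x \<bullet> (p + grad \<phi> x))"
    using assms(1) periodic_grad[OF assms(3,4)] by (simp add: periodic_def)
  moreover have "continuous_on UNIV (\<lambda>x. V x \<bullet> (p + grad \<phi> x))"
    by (intro continuous_intros assms(2) Ck1_continuous_on_grad[OF assms(4)])
  ultimately obtain B where "B > 0" "\<And>x. norm (V x \<bullet> (p + grad \<phi> x)) \<le> B"
    by (rule periodic_bounded) (rule that)
  then show ?thesis
    by (intro bdd_aboveI2[where M = B]) (simp add: abs_le_iff)
qed

lemma Ck1_periodic_critical_point: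
  fixes \<phi> :: "real^'n \<Rightarrow> real"
  assumes "periodic \<phi>" "Ck 1 \<phi>"
  obtains x where "grad \<phi> x = 0"
proof -
  obtain x where "\<And>y. \<phi> x \<le> \<phi> y"
    using periodic_attains_inf[OF assms(1) Ck1_continuous_on[OF assms(2)]] by blast
  then have "(\<lambda>h. h \<bullet> grad \<phi> x) = (\<lambda>h. 0)"
    using Ck1_has_derivative_grad[OF assms(2), of x]
    by (intro differential_zero_maxmin[of x UNIV \<phi>]) auto
  then have "grad \<phi> x = 0"
    by (metis inner_eq_zero_iff)
  then show thesis
    using that by blast
qed

text \<open>At a critical point of \<phi> the expression reduces to \<open>V x \<bullet> p\<close>,
  which is bounded below independently of \<phi>. Hence the real-valued \<open>INF\<close> in
  \<open>c_inf_max\<close> is a genuine infimum.\<close>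

lemma bdd_below_c_inf_max:
  fixes V :: "real^'n \<Rightarrow> real^'n"
  assumes V: "periodic V" "continuous_on UNIV V"
  shows "bdd_below ((\<lambda>\<phi>. SUP x. V x \<bullet> (p + grad \<phi> x)) ` {\<phi>. periodic \<phi> \<and> Ck 1 \<phi>})"
proof -
  obtain B where B: "\<And>x. norm (V x) \<le> B"
    using periodic_bounded[OF V] by blast
  show ?thesis
  proof (rule bdd_belowI2)
    fix \<phi> :: "real^'n \<Rightarrow> real" assume "\<phi> \<in> {\<phi>. periodic \<phi> \<and> Ck 1 \<phi>}"
    then have \<phi>: "periodic \<phi>" "Ck 1 \<phi>"
      by auto
    obtain x where x: "grad \<phi> x = 0"
      using Ck1_periodic_critical_point[OF \<phi>] by blast
    have "\<bar>V x \<bullet> p\<bar> \<le> B * norm p"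
      using Cauchy_Schwarz_ineq2[of "V x" p] mult_right_mono[OF B[of x], of "norm p"] by simp
    then have "- (B * norm p) \<le> V x \<bullet> (p + grad \<phi> x)"
      using x by simp
    also have "\<dots> \<le> (SUP x. V x \<bullet> (p + grad \<phi> x))"
      by (intro cSUP_upper bdd_above_inner_grad[OF V \<phi>]) simp
    finally show "- (B * norm p) \<le> (SUP x. V x \<bullet> (p + grad \<phi> x))" .
  qed
qed

lemma c_inf_max_le:
  fixes V :: "real^'n \<Rightarrow> real^'n"
  assumes "periodic V" "continuous_on UNIV V"
    and "periodic \<phi>" "Ck 1 \<phi>" "\<And>x. V x \<bullet> (p + grad \<phi> x) \<le> c"
  shows "c_inf_max V p \<le> c"
  unfolding c_inf_max_def
  by (rule cINF_lower2[OF bdd_below_c_inf_max[OF assms(1,2)], of \<phi>])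
    (auto intro: cSUP_least simp: assms simp del: Ck.simps One_nat_def)

lemma periodic_Ck1_0: "periodic (\<lambda>x::real^'n. 0::real) \<and> Ck 1 (\<lambda>x::real^'n. 0::real)"
  using Ck1_GDERIV_I[OF GDERIV_const[of 0]] by (simp add: periodic_def)

lemma c_inf_max_approx:
  fixes V :: "real^'n \<Rightarrow> real^'n"
  assumes V: "periodic V" "continuous_on UNIV V" and e: "e > 0"
  obtains \<phi> where "periodic \<phi>" and "Ck 1 \<phi>" and "\<And>x. V x \<bullet> (p + grad \<phi> x) \<le> c_inf_max V p + e"
proof -
  let ?S = "{\<phi>::real^'n \<Rightarrow> real. periodic \<phi> \<and> Ck 1 \<phi>}"
  have "?S \<noteq> {}"
    using periodic_Ck1_0 by blast
  moreover have "c_inf_max V p < c_inf_max V p + e"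
    using e by simp
  ultimately obtain \<phi> where \<phi>: "periodic \<phi>" "Ck 1 \<phi>" "(SUP x. V x \<bullet> (p + grad \<phi> x)) < c_inf_max V p + e"
    unfolding c_inf_max_def using cINF_less_iff[OF _ bdd_below_c_inf_max[OF V]] by blast
  have "V x \<bullet> (p + grad \<phi> x) \<le> (SUP x. V x \<bullet> (p + grad \<phi> x))" for x
    by (intro cSUP_upper bdd_above_inner_grad[OF V \<phi>(1,2)]) simp
  with \<phi> show thesis
    by (intro that[of \<phi>]) (auto intro: order_trans less_imp_le simp del: Ck.simps One_nat_def)
qed

text \<open>If \<phi> competes for \<open>l *\<^sub>R p\<close>, then \<open>\<phi> / l\<close>
  competes for \<open>p\<close> with the value divided by \<open>l\<close>.\<close>

lemma c_inf_max_scaleR: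
  fixes V :: "real^'n \<Rightarrow> real^'n"
  assumes V: "periodic V" "continuous_on UNIV V" and l: "l > 0"
  shows "l * c_inf_max V p \<le> c_inf_max V (l *\<^sub>R p)"
proof (rule field_le_epsilon)
  fix e :: real assume "e > 0"
  then obtain \<phi> where \<phi>: "periodic \<phi>" "Ck 1 \<phi>"
    "\<And>x. V x \<bullet> (l *\<^sub>R p + grad \<phi> x) \<le> c_inf_max V (l *\<^sub>R p) + e"
    using c_inf_max_approx[OF V] by blast
  have g: "GDERIV (\<lambda>x. \<phi> x / l) x :> (1 / l) *\<^sub>R grad \<phi> x" for x
    using Ck1_has_derivative_grad[OF \<phi>(2), of x] l unfolding gderiv_def
    by (auto intro!: derivative_eq_intros simp: field_simps)
  have "c_inf_max V p \<le> (c_inf_max V (l *\<^sub>R p) + e) / l"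
  proof (rule c_inf_max_le[OF V])
    show "periodic (\<lambda>x. \<phi> x / l)"
      using \<phi>(1) by (simp add: periodic_def)
    show "Ck 1 (\<lambda>x. \<phi> x / l)"
      using g by (rule Ck1_GDERIV_I) (intro continuous_intros Ck1_continuous_on_grad \<phi>(2))
    show "V x \<bullet> (p + grad (\<lambda>x. \<phi> x / l) x) \<le> (c_inf_max V (l *\<^sub>R p) + e) / l" for x
      using \<phi>(3)[of x] l unfolding grad_eqI[OF g]
      by (simp add: inner_add_right pos_le_divide_eq distrib_right mult.commute[of l])
  qed
  then show "l * c_inf_max V p \<le> c_inf_max V (l *\<^sub>R p) + e"
    using l by (simp add: field_simps)
qed

lemma c_inf_max_le_visc_subsolution:
  fixes V :: "real^'n \<Rightarrow> real^'n"
  assumes V: "periodic V" "Ck 1 V" and G: "periodic G" "continuous_on UNIV G"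
    and sub: "visc_subsolution (\<lambda>x q. V x \<bullet> (p + q)) c G"
  shows "c_inf_max V p \<le> c"
proof (rule field_le_epsilon)
  fix e :: real assume "e > 0"
  then obtain \<phi> where "periodic \<phi>" "Ck 1 \<phi>" "\<And>x. V x \<bullet> (p + grad \<phi> x) \<le> c + e"
    using visc_subsolution_linear_approx[OF V G sub] by blast
  then show "c_inf_max V p \<le> c + e"
    by (rule c_inf_max_le[OF V(1) Ck1_continuous_on[OF V(2)]])
qed

subsection \<open>Bounds for the flame speeds\<close>

lemma visc_subsolution_mono:
  assumes "visc_subsolution H c u" and "\<And>x q. H x q \<le> c \<Longrightarrow> H' x q \<le> c'"
  shows "visc_subsolution H' c' u"
  using assms unfolding visc_subsolution_def by blast

text \<open>\<open>G - \<phi>\<close> attains its minimum on the torus, and there \<phi> itself is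
  an admissible test function. No regularization of \<open>G\<close> is involved on this
  side.\<close>

lemma visc_supersolution_le:
  fixes G :: "real^'n \<Rightarrow> real"
  assumes sup: "visc_supersolution H c G" and G: "periodic G" "continuous_on UNIV G"
    and \<phi>: "periodic \<phi>" "Ck 1 \<phi>" and H: "\<And>x. H x (grad \<phi> x) \<le> C"
  shows "c \<le> C"
proof -
  have "periodic (\<lambda>x. G x - \<phi> x)"
    using G(1) \<phi>(1) by (simp add: periodic_def)
  moreover have "continuous_on UNIV (\<lambda>x. G x - \<phi> x)"
    by (intro continuous_intros G(2) Ck1_continuous_on[OF \<phi>(2)])
  ultimately obtain x where "\<And>y. G x - \<phi> x \<le> G y - \<phi> y"
    using periodic_attains_inf[of "\<lambda>x. G x - \<phi> x"] by blast
  then have "\<forall>\<^sub>F y in at x. G y - \<phi> y \<ge> G x - \<phi> x"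
    by simp
  then have "H x (grad \<phi> x) \<ge> c"
    using sup \<phi>(2) unfolding visc_supersolution_def by blast
  with H show ?thesis
    using order_trans by blast
qed

lemma is_alpha_ge:
  fixes V :: "real^'n \<Rightarrow> real^'n"
  assumes V: "periodic V" "Ck 1 V" and A: "A > 0" and a: "is_alpha V A p a"
  shows "c_inf_max V p \<le> a / A"
proof -
  \<comment> \<open>Subsolutions are given only for right sides above \<open>a\<close>, so the
    excess \<open>e\<close> is removed at the end.\<close>
  have "A * c_inf_max V p \<le> a + e" if "e > 0" for e
  proof -
    obtain G where G: "periodic G" "continuous_on UNIV G"
      and sub: "visc_subsolution (G_hamiltonian V A p) (a + e) G"
      using a \<open>e > 0\<close> unfolding is_alpha_def by blast
    have "V x \<bullet> (p + q) \<le> (a + e) / A" if "G_hamiltonian V A p x q \<le> a + e" for x q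
    proof -
      have "A * (V x \<bullet> (p + q)) \<le> a + e"
        using that norm_ge_zero[of "p + q"] unfolding G_hamiltonian_def by linarith
      then show ?thesis
        using A by (simp add: field_simps)
    qed
    then have "c_inf_max V p \<le> (a + e) / A"
      by (rule c_inf_max_le_visc_subsolution[OF V G visc_subsolution_mono[OF sub]])
    then show ?thesis
      using A by (simp add: field_simps)
  qed
  then have "A * c_inf_max V p \<le> a"
    by (rule field_le_epsilon)
  then show ?thesis
    using A by (simp add: field_simps)
qed

lemma is_beta_ge:
  fixes V :: "real^'n \<Rightarrow> real^'n"
  assumes V: "periodic V" "Ck 1 V" and A: "A > 0" and b: "is_beta V A p b"
  shows "c_inf_max V p \<le> b / A"
proof -
  obtain F where F: "periodic F" "continuous_on UNIV F"
    and sub: "visc_subsolution (F_hamiltonian V A p) b F"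
    using b unfolding is_beta_def by blast
  have "V x \<bullet> (p + q) \<le> b / A" if "F_hamiltonian V A p x q \<le> b" for x q
  proof -
    have "A * (V x \<bullet> (p + q)) \<le> b"
      using that zero_le_power2[of "norm (p + q)"] unfolding F_hamiltonian_def by linarith
    then show ?thesis
      using A by (simp add: field_simps)
  qed
  then show ?thesis
    by (rule c_inf_max_le_visc_subsolution[OF V F visc_subsolution_mono[OF sub]])
qed

text \<open>One almost optimal \<phi>, chosen before \<open>A\<close>, serves all \<open>A\<close>.
  Hence \<open>K\<close>, a bound for the norm of \<open>p + grad \<phi> x\<close>, depends on
  \<open>e\<close> but not on \<open>A\<close>.\<close>

lemma alpha_beta_upper_bound:
  fixes V :: "real^'n \<Rightarrow> real^'n"
  assumes V: "periodic V" "continuous_on UNIV V" and e: "e > 0"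
  obtains K where "\<And>A a. A > 0 \<Longrightarrow> is_alpha V A p a \<Longrightarrow> a \<le> K + A * (c_inf_max V p + e)"
    and "\<And>A b. A > 0 \<Longrightarrow> is_beta V A p b \<Longrightarrow> b \<le> K\<^sup>2 + A * (c_inf_max V p + e)"
proof -
  obtain \<phi> where \<phi>: "periodic \<phi>" "Ck 1 \<phi>" "\<And>x. V x \<bullet> (p + grad \<phi> x) \<le> c_inf_max V p + e"
    using c_inf_max_approx[OF V e] by blast
  have "periodic (\<lambda>x. p + grad \<phi> x)"
    using periodic_grad[OF \<phi>(1,2)] by (simp add: periodic_def)
  moreover have "continuous_on UNIV (\<lambda>x. p + grad \<phi> x)"
    by (intro continuous_intros Ck1_continuous_on_grad[OF \<phi>(2)])
  ultimately obtain K where "K > 0" and K: "\<And>x. norm (p + grad \<phi> x) \<le> K"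
    by (rule periodic_bounded) (rule that)
  show thesis
  proof
    fix A a assume A: "A > 0" and a: "is_alpha V A p a"
    show "a \<le> K + A * (c_inf_max V p + e)"
    proof (rule field_le_epsilon)
      fix e' :: real assume "e' > 0"
      then obtain G where G: "periodic G" "continuous_on UNIV G"
        and sup: "visc_supersolution (G_hamiltonian V A p) (a - e') G"
        using a unfolding is_alpha_def by blast
      have "a - e' \<le> K + A * (c_inf_max V p + e)"
        using A by (intro visc_supersolution_le[OF sup G \<phi>(1,2)])
          (auto simp: G_hamiltonian_def intro!: add_mono K \<phi>(3))
      then show "a \<le> K + A * (c_inf_max V p + e) + e'"
        by simp
    qed
  next
    fix A b assume A: "A > 0" and b: "is_beta V A p b"
    then obtain F where F: "periodic F" "continuous_on UNIV F"
      and sup: "visc_supersolution (F_hamiltonian V A p) b F"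
      unfolding is_beta_def by blast
    show "b \<le> K\<^sup>2 + A * (c_inf_max V p + e)"
      using A by (intro visc_supersolution_le[OF sup F \<phi>(1,2)])
        (auto simp: F_hamiltonian_def intro!: add_mono power_mono K \<phi>(3))
  qed
qed

section \<open>Passage to the limit of large \<open>A\<close>\<close>

lemma KPP_deriv_pos:
  assumes "KPP f"
  shows "deriv01 f 0 > 0"
proof -
  have "\<forall>s\<in>{0<..<1}. 0 < f s \<and> f s \<le> s * deriv01 f 0"
    using assms unfolding KPP_def by (elim conjE)
  from bspec[OF this, of "1/2"] show ?thesis
    by simp
qed

lemma flame_speed_limit:
  fixes g :: "real \<Rightarrow> real"
  assumes lower: "\<And>A. A > 0 \<Longrightarrow> c \<le> g A / A"
    and upper: "\<And>e. e > 0 \<Longrightarrow> \<exists>K. \<forall>A>0. g A \<le> K + A * (c + e)"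
  shows "((\<lambda>A. g A / A) \<longlongrightarrow> c) at_top"
proof (rule order_tendstoI)
  fix a assume "a < c"
  then show "\<forall>\<^sub>F A in at_top. a < g A / A"
    using lower by (intro eventually_mono[OF eventually_gt_at_top[of 0]]) (meson less_le_trans)
next
  fix a assume a: "c < a"
  define e where "e = (a - c) / 2"
  have e: "e > 0" "a = c + e + e"
    using a by (simp_all add: e_def field_simps)
  obtain K where K: "\<And>A. A > 0 \<Longrightarrow> g A \<le> K + A * (c + e)"
    using upper[OF e(1)] by blast
  \<comment> \<open>Beyond this threshold \<open>K\<close> is less than \<open>e * A\<close> and is
    absorbed by the second half of the gap between \<open>c\<close> and \<open>a\<close>.\<close>
  have "g A / A < a" if "A > max 0 (K / e)" for A
  proof -
    have "A > 0" "K < e * A"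
      using that e(1) by (auto simp: field_simps)
    then show ?thesis
      using K[of A] unfolding e(2) by (simp add: pos_divide_less_eq algebra_simps)
  qed
  then show "\<forall>\<^sub>F A in at_top. g A / A < a"
    by (rule eventually_mono[OF eventually_gt_at_top])
qed

theorem theorem3p1:
  fixes V :: "real^'n \<Rightarrow> real^'n"
    and f :: "real \<Rightarrow> real"
    and p :: "real^'n"
    and \<alpha> \<beta> :: "real \<Rightarrow> real^'n \<Rightarrow> real"
  assumes "periodic V" and "smooth V" and "divergence_free V" and "mean_zero V"
    and "KPP f"
    and "\<And>A q. A > 0 \<Longrightarrow> is_alpha V A q (\<alpha> A q)"
    and "\<And>A q. A > 0 \<Longrightarrow> is_beta V A q (\<beta> A q)"
  shows "((\<lambda>A. \<alpha> A p / A) \<longlongrightarrow> c_inf_max V p) at_top \<and>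
         ((\<lambda>A. \<beta> A p / A) \<longlongrightarrow> c_inf_max V p) at_top \<and>
         ((\<lambda>A. gamma_speed f (\<beta> A) p / A) \<longlongrightarrow> c_inf_max V p) at_top \<and>
         (((\<lambda>A. \<alpha> A p / A) \<longlongrightarrow> 0) at_top \<longleftrightarrow>
          ((\<lambda>A. gamma_speed f (\<beta> A) p / A) \<longlongrightarrow> 0) at_top)"
proof -
  let ?c = "c_inf_max V p"
  have V: "periodic V" "Ck 1 V"
    using assms(1,2) unfolding smooth_def by blast+
  have V0: "continuous_on UNIV V"
    using Ck1_continuous_on[OF V(2)] .
  have f: "deriv01 f 0 > 0"
    by (rule KPP_deriv_pos[OF assms(5)])
  have lim_\<alpha>: "((\<lambda>A. \<alpha> A p / A) \<longlongrightarrow> ?c) at_top"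
  proof (rule flame_speed_limit)
    show "?c \<le> \<alpha> A p / A" if "A > 0" for A
      using is_alpha_ge[OF V that assms(6)[OF that]] .
    show "\<exists>K. \<forall>A>0. \<alpha> A p \<le> K + A * (?c + e)" if "e > 0" for e
      using alpha_beta_upper_bound[OF V(1) V0 that] assms(6) by metis
  qed
  have \<beta>_upper: "\<exists>K. \<forall>A>0. \<beta> A p \<le> K + A * (?c + e)" if "e > 0" for e
    using alpha_beta_upper_bound[OF V(1) V0 that] assms(7) by metis
  have lim_\<beta>: "((\<lambda>A. \<beta> A p / A) \<longlongrightarrow> ?c) at_top"
  proof (rule flame_speed_limit)
    show "?c \<le> \<beta> A p / A" if "A > 0" for A
      using is_beta_ge[OF V that assms(7)[OF that]] .
  qed (rule \<beta>_upper)
  \<comment> \<open>The bound is uniform in \<open>l\<close>: the factor \<open>l\<close> gained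
    from homogeneity cancels the denominator, and the positive term with \<open>deriv01 f 0\<close>
    is dropped.\<close>
  have \<gamma>_lower: "A * ?c \<le> (deriv01 f 0 + \<beta> A (l *\<^sub>R p)) / l" if "A > 0" "l > 0" for A l
  proof -
    have "l * ?c \<le> \<beta> A (l *\<^sub>R p) / A"
      using c_inf_max_scaleR[OF V(1) V0 that(2)] is_beta_ge[OF V that(1) assms(7)[OF that(1)]]
      by (rule order_trans)
    then have "l * (A * ?c) \<le> \<beta> A (l *\<^sub>R p)"
      using that by (simp add: field_simps)
    then show ?thesis
      using f that by (simp add: pos_le_divide_eq mult.commute)
  qed
  have lim_\<gamma>: "((\<lambda>A. gamma_speed f (\<beta> A) p / A) \<longlongrightarrow> ?c) at_top"
  proof (rule flame_speed_limit)
    fix A :: real assume A: "A > 0"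
    have "A * ?c \<le> gamma_speed f (\<beta> A) p"
      unfolding gamma_speed_def using \<gamma>_lower[OF A] by (intro cINF_greatest) auto
    then show "?c \<le> gamma_speed f (\<beta> A) p / A"
      using A by (simp add: field_simps)
  next
    fix e :: real assume "e > 0"
    then obtain K where K: "\<And>A. A > 0 \<Longrightarrow> \<beta> A p \<le> K + A * (?c + e)"
      using \<beta>_upper by blast
    have "gamma_speed f (\<beta> A) p \<le> (deriv01 f 0 + K) + A * (?c + e)" if A: "A > 0" for A
    proof -
      \<comment> \<open>The infimum is taken in the reals, so it lies below the value at
        \<open>l = 1\<close> only once boundedness is known.\<close>
      have "bdd_below ((\<lambda>l. (deriv01 f 0 + \<beta> A (l *\<^sub>R p)) / l) ` {0<..})"
        using \<gamma>_lower[OF A] by (intro bdd_belowI2[where m = "A * ?c"]) auto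
      then have "gamma_speed f (\<beta> A) p \<le> (deriv01 f 0 + \<beta> A (1 *\<^sub>R p)) / 1"
        unfolding gamma_speed_def by (rule cINF_lower) simp
      then show ?thesis
        using K[OF A] by simp
    qed
    then show "\<exists>K. \<forall>A>0. gamma_speed f (\<beta> A) p \<le> K + A * (?c + e)"
      by blast
  qed
  \<comment> \<open>By uniqueness of limits, either form of bending amounts to the vanishing of the
    common limit.\<close>
  have "((\<lambda>A. \<alpha> A p / A) \<longlongrightarrow> 0) at_top \<longleftrightarrow> ?c = 0"
    using lim_\<alpha> tendsto_unique[OF trivial_limit_at_top_linorder] by metis
  moreover have "((\<lambda>A. gamma_speed f (\<beta> A) p / A) \<longlongrightarrow> 0) at_top \<longleftrightarrow> ?c = 0"
    using lim_\<gamma> tendsto_unique[OF trivial_limit_at_top_linorder] by metis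
  ultimately show ?thesis
    using lim_\<alpha> lim_\<beta> lim_\<gamma> by blast
qed

end
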